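(* Let $K$ be a compact set in $\mathbb C$ and suppose that $0\in\partial K$. If $0$ is an accessible boundary point of $K$, then there is a continuous branch of $\log z$ on $K\setminus\{0\}$; that is, there is a continuous function $h:K\setminus\{0\}\to\mathbb C$ with $e^{h(z)}=z$ for every $z\in K\setminus\{0\}$.
   Context: A boundary point $z_0$ of a compact set $K\subseteq\mathbb C$ is said to be accessible if there is a Jordan arc (a continuous injective map) $\gamma:\,]0,1[\,\to\mathbb C\setminus K$ coming from infinity and ending at $z_0$, that is, $\lim_{t\to0}\gamma(t)=\infty$ and $\lim_{t\to1}\gamma(t)=z_0$. *)

theory Defs
  imports "HOL-Analysis.Analysis"
begin

(* Accessibility from infinity; the notion is meant for compact K. The Jordan arc is
   parametrised by the open interval, so the library's "arc" (on {0..1}) does not apply,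
   and only values of g on {0<..<1} matter. *)
definition accessible_boundary_point :: "complex set \<Rightarrow> complex \<Rightarrow> bool" where
  "accessible_boundary_point K z0 \<longleftrightarrow>
     z0 \<in> frontier K \<and>
     (\<exists>g :: real \<Rightarrow> complex.
        continuous_on {0<..<1} g \<and> inj_on g {0<..<1} \<and> g ` {0<..<1} \<subseteq> - K \<and>
        filterlim g at_infinity (at_right 0) \<and> (g \<longlongrightarrow> z0) (at_left 1))"

end

theory Submission
  imports Defs
begin

text \<open>Translating by the points of the arc, the maps \<open>z \<mapsto> z - g t\<close> never vanish on \<open>K - {0}\<close>
  and deform the identity (at the endpoint \<open>0\<close> of the arc) into \<open>z \<mapsto> z - w\<close> with \<open>w\<close> so far away
  that the latter is homotopic to the constant \<open>- w\<close>. Hence the inclusion of \<open>K - {0}\<close> into the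
  punctured plane is inessential, which is equivalent to the existence of a continuous logarithm.\<close>

text \<open>The homotopy is \<open>z - p t\<close>, which vanishes only if \<open>z = p t\<close>;
  disjointness of the path from \<open>S\<close> excludes this.\<close>

lemma homotopic_with_translations_along_path:
  fixes S :: "'a::real_normed_vector set"
  assumes "path p" and "path_image p \<inter> S = {}"
  shows "homotopic_with_canon (\<lambda>_. True) S (- {0}) (\<lambda>z. z - pathstart p) (\<lambda>z. z - pathfinish p)"
proof -
  have "continuous_on ({0..1} \<times> S) (\<lambda>y. p (fst y))"
    using \<open>path p\<close> unfolding path_def
    by (rule continuous_on_compose2) (auto intro: continuous_on_fst continuous_on_id)
  then have "continuous_on ({0..1} \<times> S) (\<lambda>y. snd y - p (fst y))"
    by (intro continuous_on_diff continuous_on_snd continuous_on_id)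
  moreover have "p t \<notin> S" if "t \<in> {0..1}" for t
    using assms(2) that unfolding path_image_def by blast
  ultimately show ?thesis
    unfolding homotopic_with_def pathstart_def pathfinish_def
    by (intro exI [of _ "\<lambda>y. snd y - p (fst y)"]) auto
qed

text \<open>The straight-line homotopy works: its value at time \<open>u\<close> is
  \<open>(1 - u) *\<^sub>R z - w\<close>, and shrinking \<open>z\<close> cannot make it as long as
  \<open>w\<close>.\<close>

lemma homotopic_with_far_translation_const:
  fixes S :: "'a::real_normed_vector set"
  assumes "\<And>z. z \<in> S \<Longrightarrow> norm z < norm w"
  shows "homotopic_with_canon (\<lambda>_. True) S (- {0}) (\<lambda>z. z - w) (\<lambda>_. - w)"
proof (rule homotopic_with_linear)
  fix z assume "z \<in> S"
  have "(1 - u) *\<^sub>R (z - w) + u *\<^sub>R (- w) \<noteq> 0" if "0 \<le> u" "u \<le> 1" for u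
  proof
    assume "(1 - u) *\<^sub>R (z - w) + u *\<^sub>R (- w) = 0"
    then have "w = (1 - u) *\<^sub>R z"
      by (simp add: algebra_simps)
    then have "norm w \<le> norm z"
      using that by (simp add: mult_left_le_one_le)
    with assms [OF \<open>z \<in> S\<close>] show False
      by simp
  qed
  then show "closed_segment (z - w) (- w) \<subseteq> - {0}"
    by (auto simp: closed_segment_def)
qed (intro continuous_intros)+

theorem theorem3p3:
  fixes K :: "complex set"
  assumes "compact K"
    and "0 \<in> frontier K"
    and "accessible_boundary_point K 0"
  shows "\<exists>h :: complex \<Rightarrow> complex. continuous_on (K - {0}) h \<and> (\<forall>z \<in> K - {0}. exp (h z) = z)"
proof -
  obtain g :: "real \<Rightarrow> complex" where contg: "continuous_on {0<..<1} g"
    and gK: "g ` {0<..<1} \<subseteq> - K"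
    and g0: "filterlim g at_infinity (at_right 0)" and g1: "(g \<longlongrightarrow> 0) (at_left 1)"
    using assms(3) unfolding accessible_boundary_point_def by blast
  obtain B where B: "\<And>z. z \<in> K \<Longrightarrow> norm z \<le> B"
    using compact_imp_bounded [OF assms(1)] by (auto simp: bounded_iff)
  \<comment> \<open>Near parameter 0 the arc is farther from the origin than all of
    \<open>K\<close>; \<open>a\<close> is one such parameter, and the arc is cut off there.\<close>
  have "\<forall>\<^sub>F t in at_right 0. norm (g t) > B"
    using filterlim_at_infinity_imp_norm_at_top [OF g0] by (simp add: filterlim_at_top_dense)
  moreover have "\<forall>\<^sub>F t in at_right 0. t \<in> {0<..<1::real}"
    by (rule eventually_at_right_real) simp
  ultimately have "\<forall>\<^sub>F t in at_right 0. B < norm (g t) \<and> t \<in> {0<..<1}"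
    by (rule eventually_conj)
  then obtain a where a: "B < norm (g a)" "0 < a" "a < 1"
    using eventually_happens' [OF trivial_limit_at_right_real] by force
  \<comment> \<open>The value \<open>g 1\<close> is arbitrary; replacing it by the limit 0 closes up
    the arc continuously.\<close>
  define G where "G = g(1 := 0)"
  have "continuous_on {a..1} G"
  proof (rule continuous_on_IccI)
    show "(G \<longlongrightarrow> G 1) (at_left 1)"
      using Lim_transform_eventually [OF g1, of G] by (simp add: G_def eventually_at_filter)
    \<comment> \<open>The range of \<open>t\<close> includes \<open>a\<close> itself, so the
      one-sided limit at \<open>a\<close> follows too.\<close>
    have G: "G \<midarrow>t\<rightarrow> G t" if "0 < t" "t < 1" for t
    proof -
      have "continuous_on {0<..<1} G"
        using contg by (rule continuous_on_eq) (auto simp: G_def)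
      then show ?thesis
        using that by (simp add: continuous_on_eq_continuous_at isCont_def)
    qed
    show "G \<midarrow>t\<rightarrow> G t" if "a < t" "t < 1" for t
      using G that \<open>0 < a\<close> by simp
    show "(G \<longlongrightarrow> G a) (at_right a)"
      using G [of a] a by (simp add: filterlim_at_split)
  qed (use a in simp)
  define p where "p = (\<lambda>s. G (a + s * (1 - a)))"
  have range: "a + s * (1 - a) \<in> {a..1}" if "s \<in> {0..1}" for s
  proof -
    have "0 \<le> s * (1 - a)" "s * (1 - a) \<le> 1 - a"
      using that a by (auto intro: mult_left_le_one_le)
    then show ?thesis
      unfolding atLeastAtMost_iff by linarith
  qed
  have "path p"
    unfolding path_def p_def
    by (rule continuous_on_compose2 [OF \<open>continuous_on {a..1} G\<close>])
       (use range in \<open>auto intro!: continuous_intros\<close>)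
  \<comment> \<open>The closed arc meets \<open>K\<close> only in its endpoint 0, which is exactly
    the point removed from \<open>K\<close>.\<close>
  moreover have "G ` {a..1} \<inter> (K - {0}) = {}"
    using gK a by (auto simp: G_def image_subset_iff)
  then have "path_image p \<inter> (K - {0}) = {}"
    using range unfolding path_image_def p_def by blast
  moreover have "pathstart p = g a" "pathfinish p = 0"
    using a by (simp_all add: p_def G_def pathstart_def pathfinish_def)
  ultimately have "homotopic_with_canon (\<lambda>_. True) (K - {0}) (- {0}) (\<lambda>z. z - g a) (\<lambda>z. z)"
    using homotopic_with_translations_along_path [of p "K - {0}"] by simp
  moreover have "homotopic_with_canon (\<lambda>_. True) (K - {0}) (- {0}) (\<lambda>z. z - g a) (\<lambda>_. - g a)"
    using a(1) B by (force intro: homotopic_with_far_translation_const)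
  ultimately have "homotopic_with_canon (\<lambda>_. True) (K - {0}) (- {0}) (\<lambda>z. z) (\<lambda>_. - g a)"
    using homotopic_with_trans homotopic_with_symD by blast
  \<comment> \<open>A logarithm of the inclusion map, as a map into the punctured plane, is a branch
    of \<open>log z\<close>.\<close>
  then obtain h where "continuous_on (K - {0}) h" "\<forall>z \<in> K - {0}. z = exp (h z)"
    using inessential_eq_continuous_logarithm [of "K - {0}" "\<lambda>z. z"] by blast
  then show ?thesis
    by metis
qed

end
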